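(* Let $R$ be a P$v$MD. (1) If $R$ is a $t\#\#$-domain, then $R$ is a $tRTP$-domain. (2) If $R$ is a $tRTP$-domain and each $t$-prime of $R$ is branched, then $R$ is a $t\#\#$-domain.
   Context: $R$ is an integral domain with quotient field $K\neq R$. For nonzero $R$-submodules $A,B$ of $K$, $(A:B)=\{x\in K: xB\subseteq A\}$. For a nonzero fractional ideal $I$, $I_v=(R:(R:I))$, $I_t=\bigcup\{J_v: J\subseteq I\text{ nonzero finitely generated}\}$; $I$ is a $t$-ideal if $I=I_t$; a $t$-prime is a prime $t$-ideal; a $t$-maximal ideal is an ideal maximal among proper $t$-ideals. $R$ is a P$v$MD if $R_M$ is a valuation domain for every $t$-maximal $M$. A prime $P$ is branched if there is a $P$-primary ideal different from $P$. $R$ is a $t\#\#$-domain if $\bigcap_{P\in\mathcal P_1}R_P\neq\bigcap_{P\in\mathcal P_2}R_P$ for any two distinct sets $\mathcal P_1,\mathcal P_2$ of pairwise incomparable $t$-prime ideals of $R$. $R$ is a $tRTP$-domain if for each nonzero ideal $I$, either $(I(R:I))_t=R$ or $(I(R:I))_t$ is a radical ideal. *)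

theory Defs
  imports Main
begin

text \<open>The domain R is modelled as a subring of a field (of type 'k) whose quotient
field is the whole of 'k.  Fractional ideals / R-submodules are subsets of 'k.\<close>

definition subring :: "'k::field set \<Rightarrow> bool" where
  "subring R \<longleftrightarrow> 0 \<in> R \<and> 1 \<in> R \<and> (\<forall>a\<in>R. \<forall>b\<in>R. a + b \<in> R \<and> a - b \<in> R \<and> a * b \<in> R)"

definition quotient_field_is_univ :: "'k::field set \<Rightarrow> bool" where
  "quotient_field_is_univ R \<longleftrightarrow> (\<forall>x. \<exists>a\<in>R. \<exists>b\<in>R. b \<noteq> 0 \<and> x = a / b)"

definition ideal :: "'k::field set \<Rightarrow> 'k set \<Rightarrow> bool" where
  "ideal R I \<longleftrightarrow> I \<subseteq> R \<and> 0 \<in> I \<and> (\<forall>a\<in>I. \<forall>b\<in>I. a + b \<in> I) \<and> (\<forall>r\<in>R. \<forall>a\<in>I. r * a \<in> I)"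

definition prime_ideal :: "'k::field set \<Rightarrow> 'k set \<Rightarrow> bool" where
  "prime_ideal R P \<longleftrightarrow> ideal R P \<and> P \<noteq> R \<and>
     (\<forall>a\<in>R. \<forall>b\<in>R. a * b \<in> P \<longrightarrow> a \<in> P \<or> b \<in> P)"

definition rad :: "'k::field set \<Rightarrow> 'k set \<Rightarrow> 'k set" where
  "rad R I = {x \<in> R. \<exists>n::nat. x ^ n \<in> I}"

definition radical_ideal :: "'k::field set \<Rightarrow> 'k set \<Rightarrow> bool" where
  "radical_ideal R I \<longleftrightarrow> ideal R I \<and> rad R I = I"

definition primary_for :: "'k::field set \<Rightarrow> 'k set \<Rightarrow> 'k set \<Rightarrow> bool" where
  "primary_for R P Q \<longleftrightarrow> ideal R Q \<and> Q \<noteq> R \<and> rad R Q = P \<and>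
     (\<forall>a\<in>R. \<forall>b\<in>R. a * b \<in> Q \<longrightarrow> a \<in> Q \<or> b \<in> rad R Q)"

definition branched :: "'k::field set \<Rightarrow> 'k set \<Rightarrow> bool" where
  "branched R P \<longleftrightarrow> prime_ideal R P \<and> (\<exists>Q. primary_for R P Q \<and> Q \<noteq> P)"

definition colon :: "'k::field set \<Rightarrow> 'k set \<Rightarrow> 'k set" where
  "colon A B = {x. \<forall>b\<in>B. x * b \<in> A}"

definition submod_prod :: "'k::field set \<Rightarrow> 'k set \<Rightarrow> 'k set" where
  "submod_prod A B = {\<Sum>i<(n::nat). a i * b i | n a b. \<forall>i<n. a i \<in> A \<and> b i \<in> B}"

definition fg_submodule :: "'k::field set \<Rightarrow> 'k set \<Rightarrow> bool" where
  "fg_submodule R J \<longleftrightarrow> (\<exists>F. finite F \<and> J = {\<Sum>a\<in>F. r a * a | r. \<forall>a\<in>F. r a \<in> R})"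

definition v_closure :: "'k::field set \<Rightarrow> 'k set \<Rightarrow> 'k set" where
  "v_closure R I = colon R (colon R I)"

definition t_closure :: "'k::field set \<Rightarrow> 'k set \<Rightarrow> 'k set" where
  "t_closure R I = \<Union>{v_closure R J | J. J \<subseteq> I \<and> J \<noteq> {0} \<and> fg_submodule R J}"

definition t_ideal :: "'k::field set \<Rightarrow> 'k set \<Rightarrow> bool" where
  "t_ideal R I \<longleftrightarrow> ideal R I \<and> I \<noteq> {0} \<and> t_closure R I = I"

definition t_prime :: "'k::field set \<Rightarrow> 'k set \<Rightarrow> bool" where
  "t_prime R P \<longleftrightarrow> prime_ideal R P \<and> t_ideal R P"

definition t_maximal :: "'k::field set \<Rightarrow> 'k set \<Rightarrow> bool" where
  "t_maximal R M \<longleftrightarrow> t_ideal R M \<and> M \<noteq> R \<and>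
     (\<forall>N. t_ideal R N \<and> N \<noteq> R \<and> M \<subseteq> N \<longrightarrow> N = M)"

definition loc :: "'k::field set \<Rightarrow> 'k set \<Rightarrow> 'k set" where
  "loc R P = {a / s | a s. a \<in> R \<and> s \<in> R \<and> s \<notin> P}"

text \<open>A subring V of K (with quotient field K) is a valuation domain.\<close>
definition valuation_domain :: "'k::field set \<Rightarrow> bool" where
  "valuation_domain V \<longleftrightarrow> (\<forall>x. x \<noteq> 0 \<longrightarrow> x \<in> V \<or> inverse x \<in> V)"

definition PvMD :: "'k::field set \<Rightarrow> bool" where
  "PvMD R \<longleftrightarrow> (\<forall>M. t_maximal R M \<longrightarrow> valuation_domain (loc R M))"

definition pairwise_incomparable :: "'k set set \<Rightarrow> bool" where
  "pairwise_incomparable S \<longleftrightarrow> (\<forall>P\<in>S. \<forall>Q\<in>S. P \<subseteq> Q \<longrightarrow> P = Q)"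

definition t_sharp_sharp :: "'k::field set \<Rightarrow> bool" where
  "t_sharp_sharp R \<longleftrightarrow> (\<forall>S1 S2. (\<forall>P\<in>S1. t_prime R P) \<and> (\<forall>P\<in>S2. t_prime R P) \<and>
      pairwise_incomparable S1 \<and> pairwise_incomparable S2 \<and> S1 \<noteq> S2 \<longrightarrow>
      (\<Inter>P\<in>S1. loc R P) \<noteq> (\<Inter>P\<in>S2. loc R P))"

definition tRTP :: "'k::field set \<Rightarrow> bool" where
  "tRTP R \<longleftrightarrow> (\<forall>I. ideal R I \<and> I \<noteq> {0} \<longrightarrow>
      t_closure R (submod_prod I (colon R I)) = R \<or>
      radical_ideal R (t_closure R (submod_prod I (colon R I))))"

end

theory Submission
  imports Defs
begin

text \<open>
  Both parts pass through the property that every \<open>t\<close>-prime \<open>P\<close> is sharp: some finitely generated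
  subideal of \<open>P\<close> lies only in those \<open>t\<close>-maximal ideals that contain \<open>P\<close>. In a PvMD this is
  equivalent to the \<open>t##\<close> property, because the conductor \<open>(R : (1, y))\<close> of an element \<open>y\<close> is
  \<open>t\<close>-invertible, hence \<open>t\<close>-finite.

  For (1), let \<open>A = I(R : I)\<close>, \<open>V = R\<^sub>M\<close> with \<open>M\<close> \<open>t\<close>-maximal, and suppose \<open>x\<^sup>n \<in> AV\<close> but
  \<open>x \<notin> AV\<close>. With \<open>P\<close> the radical of \<open>AV\<close> in \<open>R\<close>, there is \<open>i \<in> I\<close> such that
  \<open>xI \<subseteq> iPR\<^sub>P\<close>, so \<open>x/i\<close> sends \<open>I\<close> into \<open>R\<^sub>N\<close> for every \<open>t\<close>-maximal \<open>N \<supseteq> P\<close>. Sharpness of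
  \<open>P\<close> yields \<open>s \<in> R - M\<close> such that \<open>xs/i\<close> does so for all the other \<open>N\<close> too. Hence
  \<open>xs/i \<in> (R : I)\<close> and \<open>xs \<in> A\<close>, a contradiction.

  For (2), if \<open>P\<close> is not sharp then every \<open>P\<close>-primary ideal \<open>Q\<close> satisfies \<open>(R : Q) = (Q : Q)\<close>, so
  \<open>Q\<close> is its own trace; being \<open>t\<close>-closed it has to be radical, so that \<open>Q = P\<close>.
\<close>

section \<open>Ideals and primes of a domain inside its quotient field\<close>

locale frac_domain =
  fixes R :: "'k::field set"
  assumes subring: "subring R" and quot: "quotient_field_is_univ R"
begin

lemma R_0 [simp]: "0 \<in> R" and R_1 [simp]: "1 \<in> R"
  using subring by (auto simp: subring_def)

lemma R_add: "a \<in> R \<Longrightarrow> b \<in> R \<Longrightarrow> a + b \<in> R"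
  and R_mult: "a \<in> R \<Longrightarrow> b \<in> R \<Longrightarrow> a * b \<in> R"
  using subring by (auto simp: subring_def)

lemma R_power: "a \<in> R \<Longrightarrow> a ^ n \<in> R"
  by (induction n) (auto intro: R_mult)

lemma R_sum: "(\<And>i. i \<in> F \<Longrightarrow> f i \<in> R) \<Longrightarrow> sum f F \<in> R"
  by (induction F rule: infinite_finite_induct) (auto intro: R_add)

lemma idealD:
  assumes "ideal R I"
  shows "\<And>a. a \<in> I \<Longrightarrow> a \<in> R" and "0 \<in> I" and "\<And>a b. a \<in> I \<Longrightarrow> b \<in> I \<Longrightarrow> a + b \<in> I"
    and "\<And>r a. r \<in> R \<Longrightarrow> a \<in> I \<Longrightarrow> r * a \<in> I"
  using assms by (auto simp: ideal_def)

lemma ideal_sum: "ideal R I \<Longrightarrow> (\<And>i. i \<in> F \<Longrightarrow> f i \<in> I) \<Longrightarrow> sum f F \<in> I"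
  by (induction F rule: infinite_finite_induct) (auto intro: idealD)

lemma ideal_eq_R: "ideal R I \<Longrightarrow> 1 \<in> I \<Longrightarrow> I = R"
  using idealD[of I] by (metis mult.right_neutral subsetI subset_antisym)

lemma ideal_nonzeroE:
  assumes "ideal R I" "I \<noteq> {0}"
  obtains a where "a \<in> I" "a \<noteq> 0"
  using assms idealD(2) by blast

lemma primeD:
  assumes "prime_ideal R P"
  shows "ideal R P" and "0 \<in> P" and "1 \<notin> P" and "\<And>a. a \<in> P \<Longrightarrow> a \<in> R"
    and "\<And>a b. a \<in> R \<Longrightarrow> b \<in> R \<Longrightarrow> a * b \<in> P \<Longrightarrow> a \<in> P \<or> b \<in> P"
    and "\<And>a b. a \<in> R \<Longrightarrow> b \<in> P \<Longrightarrow> a * b \<in> P"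
  using assms ideal_eq_R[of P] by (auto simp: prime_ideal_def intro: idealD)

lemma prime_power: "prime_ideal R P \<Longrightarrow> a \<in> R \<Longrightarrow> a ^ n \<in> P \<Longrightarrow> a \<in> P"
  by (induction n) (auto dest: primeD(3) primeD(5) intro: R_power)

section \<open>The v-closure and the t-closure, in terms of finite generating sets\<close>

lemma mem_v_closure: "z \<in> v_closure R F \<longleftrightarrow> (\<forall>y. (\<forall>f\<in>F. y * f \<in> R) \<longrightarrow> z * y \<in> R)"
  by (simp add: v_closure_def colon_def)

lemma v_closure_superset: "F \<subseteq> v_closure R F"
  unfolding subset_iff mem_v_closure by (metis mult.commute)

lemma v_closure_subset: "F \<subseteq> v_closure R G \<Longrightarrow> v_closure R F \<subseteq> v_closure R G"
  unfolding subset_iff mem_v_closure by (metis mult.commute)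

lemma v_closure_mono: "F \<subseteq> G \<Longrightarrow> v_closure R F \<subseteq> v_closure R G"
  using v_closure_subset v_closure_superset by blast

lemma v_closure_scale: "z \<in> v_closure R F \<Longrightarrow> c * z \<in> v_closure R ((*) c ` F)"
  unfolding mem_v_closure ball_simps by (metis mult.assoc mult.commute)

lemma v_closure_subset_R: "F \<subseteq> R \<Longrightarrow> v_closure R F \<subseteq> R"
  unfolding subset_iff mem_v_closure by (metis mult.left_neutral mult.right_neutral)

lemma generators_in_span:
  assumes "finite F"
  shows "F \<subseteq> {\<Sum>a\<in>F. r a * a | r. \<forall>a\<in>F. r a \<in> R}"
proof
  fix f assume f: "f \<in> F"
  define r where "r a = (if a = f then 1 else 0 :: 'k)" for a
  have "r a * a = (if a = f then a else 0)" for a by (simp add: r_def)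
  then have "f = (\<Sum>a\<in>F. r a * a)" using assms f by simp
  moreover have "\<forall>a\<in>F. r a \<in> R" by (simp add: r_def)
  ultimately show "f \<in> {\<Sum>a\<in>F. r a * a | r. \<forall>a\<in>F. r a \<in> R}" by blast
qed

text \<open>\<open>colon R F\<close> depends only on the \<open>R\<close>-submodule generated by
  \<open>F\<close>, so bare finite sets can replace finitely generated submodules.\<close>

lemma v_closure_span:
  assumes "finite F"
  shows "v_closure R {\<Sum>a\<in>F. r a * a | r. \<forall>a\<in>F. r a \<in> R} = v_closure R F"
    (is "v_closure R ?S = _")
proof -
  have "F \<subseteq> ?S" using assms by (rule generators_in_span)
  moreover have "?S \<subseteq> v_closure R F"
  proof
    fix z assume "z \<in> ?S"
    then obtain r where z: "z = (\<Sum>a\<in>F. r a * a)" and r: "\<forall>a\<in>F. r a \<in> R" by blast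
    show "z \<in> v_closure R F"
      unfolding mem_v_closure
    proof (intro allI impI)
      fix y assume y: "\<forall>f\<in>F. y * f \<in> R"
      have "z * y = (\<Sum>a\<in>F. r a * (y * a))"
        by (simp add: z sum_distrib_right mult.assoc mult.commute[of y])
      also have "\<dots> \<in> R" using r y by (intro R_sum R_mult[of "r _"]) auto
      finally show "z * y \<in> R" .
    qed
  qed
  ultimately show ?thesis
    using v_closure_subset v_closure_mono by blast
qed

text \<open>The finite set \<open>F\<close> generates the submodule \<open>J\<close> of the
  definition; \<open>\<not> F \<subseteq> {0}\<close> expresses \<open>J \<noteq> {0}\<close> and
  also excludes the empty set.\<close>

lemma mem_t_closure:
  assumes I: "ideal R I"
  shows "z \<in> t_closure R I \<longleftrightarrow> (\<exists>F. finite F \<and> F \<subseteq> I \<and> \<not> F \<subseteq> {0} \<and> z \<in> v_closure R F)"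
proof
  assume "z \<in> t_closure R I"
  then obtain J where J: "z \<in> v_closure R J" "J \<subseteq> I" "J \<noteq> {0}" "fg_submodule R J"
    by (auto simp: t_closure_def)
  then obtain F where F: "finite F" "J = {\<Sum>a\<in>F. r a * a | r. \<forall>a\<in>F. r a \<in> R}"
    by (auto simp: fg_submodule_def)
  have FJ: "F \<subseteq> J" unfolding F(2) using F(1) by (rule generators_in_span)
  have "\<not> F \<subseteq> {0}"
  proof
    assume F0: "F \<subseteq> {0}"
    have "(\<Sum>a\<in>F. r a * a) = 0" for r using F0 by (intro sum.neutral) auto
    then have "J = {0}" unfolding F(2) using R_0 by (auto intro: exI[of _ "\<lambda>_. 0"])
    with J show False by simp
  qed
  moreover have "z \<in> v_closure R F" using J(1) v_closure_span[OF F(1)] F(2) by simp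
  ultimately show "\<exists>F. finite F \<and> F \<subseteq> I \<and> \<not> F \<subseteq> {0} \<and> z \<in> v_closure R F"
    using F(1) FJ J(2) by (meson order_trans)
next
  assume "\<exists>F. finite F \<and> F \<subseteq> I \<and> \<not> F \<subseteq> {0} \<and> z \<in> v_closure R F"
  then obtain F where F: "finite F" "F \<subseteq> I" "\<not> F \<subseteq> {0}" "z \<in> v_closure R F" by blast
  define J where "J = {\<Sum>a\<in>F. r a * a | r. \<forall>a\<in>F. r a \<in> R}"
  have FJ: "F \<subseteq> J" unfolding J_def using F(1) by (rule generators_in_span)
  have "J \<subseteq> I" using F(2) I by (auto simp: J_def intro!: ideal_sum idealD(4))
  moreover have "fg_submodule R J" using F(1) by (auto simp: J_def fg_submodule_def)
  moreover have "J \<noteq> {0}" using FJ F(3) by auto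
  moreover have "z \<in> v_closure R J"
    using F(4) FJ v_closure_mono by blast
  ultimately show "z \<in> t_closure R I" by (auto simp: t_closure_def)
qed

lemma t_closureI:
  "ideal R I \<Longrightarrow> finite F \<Longrightarrow> F \<subseteq> I \<Longrightarrow> \<not> F \<subseteq> {0} \<Longrightarrow> z \<in> v_closure R F \<Longrightarrow> z \<in> t_closure R I"
  by (auto simp: mem_t_closure)

lemma t_closure_superset:
  assumes "ideal R I" "I \<noteq> {0}" shows "I \<subseteq> t_closure R I"
proof
  fix z assume z: "z \<in> I"
  \<comment> \<open>A nonzero companion \<open>a\<close> is added because \<open>{z}\<close> alone
    is not admissible when \<open>z = 0\<close>.\<close>
  obtain a where a: "a \<in> I" "a \<noteq> 0" using assms by (rule ideal_nonzeroE)
  show "z \<in> t_closure R I"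
    using z a assms v_closure_superset[of "{z, a}"] by (intro t_closureI[of I "{z, a}"]) auto
qed

lemma ideal_t_closure:
  assumes I: "ideal R I" and nz: "I \<noteq> {0}"
  shows "ideal R (t_closure R I)"
  unfolding ideal_def
proof (intro conjI ballI)
  show "t_closure R I \<subseteq> R"
  proof
    fix z assume "z \<in> t_closure R I"
    then obtain F where "F \<subseteq> I" "z \<in> v_closure R F" unfolding mem_t_closure[OF I] by blast
    then show "z \<in> R" using v_closure_subset_R[of F] idealD(1)[OF I] by blast
  qed
  show "0 \<in> t_closure R I" using t_closure_superset[OF I nz] idealD(2)[OF I] by blast
next
  fix a b assume "a \<in> t_closure R I" "b \<in> t_closure R I"
  then obtain F G where F: "finite F" "F \<subseteq> I" "\<not> F \<subseteq> {0}" "a \<in> v_closure R F"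
    and G: "finite G" "G \<subseteq> I" "b \<in> v_closure R G"
    unfolding mem_t_closure[OF I] by blast
  have "a \<in> v_closure R (F \<union> G)" "b \<in> v_closure R (F \<union> G)"
    using F G v_closure_mono[of F "F \<union> G"] v_closure_mono[of G "F \<union> G"] by auto
  then have "a + b \<in> v_closure R (F \<union> G)"
    by (auto simp: mem_v_closure distrib_right intro!: R_add)
  with F G show "a + b \<in> t_closure R I" by (intro t_closureI[OF I, of "F \<union> G"]) auto
next
  fix r a assume r: "r \<in> R" and "a \<in> t_closure R I"
  then obtain F where F: "finite F" "F \<subseteq> I" "\<not> F \<subseteq> {0}" "a \<in> v_closure R F"
    unfolding mem_t_closure[OF I] by blast
  have "r * a \<in> v_closure R F" using F(4) r R_mult unfolding mem_v_closure mult.assoc by blast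
  with F show "r * a \<in> t_closure R I" by (intro t_closureI[OF I]) auto
qed

text \<open>Finite character: each element of \<open>F\<close> uses finitely many elements of
  \<open>I\<close>, and the union of these sets serves all of \<open>F\<close>. This makes
  \<open>t_closure\<close> idempotent.\<close>

lemma t_closure_finite_subset:
  assumes I: "ideal R I" and nz: "I \<noteq> {0}" and "finite F" "F \<subseteq> t_closure R I"
  shows "\<exists>G. finite G \<and> G \<subseteq> I \<and> \<not> G \<subseteq> {0} \<and> F \<subseteq> v_closure R G"
  using assms(3,4)
proof (induction F)
  case empty
  obtain a where "a \<in> I" "a \<noteq> 0" using I nz by (rule ideal_nonzeroE)
  then show ?case by (intro exI[of _ "{a}"]) auto
next
  case (insert f F)
  then obtain G where G: "finite G" "G \<subseteq> I" "\<not> G \<subseteq> {0}" "F \<subseteq> v_closure R G" by auto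
  from insert obtain H where H: "finite H" "H \<subseteq> I" "f \<in> v_closure R H"
    using mem_t_closure[OF I] by auto
  have "insert f F \<subseteq> v_closure R (G \<union> H)"
    using G H v_closure_mono[of G "G \<union> H"] v_closure_mono[of H "G \<union> H"] by blast
  with G H show ?case by (intro exI[of _ "G \<union> H"]) auto
qed

lemma t_ideal_t_closure:
  assumes I: "ideal R I" and nz: "I \<noteq> {0}"
  shows "t_ideal R (t_closure R I)"
proof -
  note T = ideal_t_closure[OF I nz]
  have nzT: "t_closure R I \<noteq> {0}"
    using t_closure_superset[OF I nz] nz idealD(2)[OF I] by blast
  have "t_closure R (t_closure R I) \<subseteq> t_closure R I"
  proof
    fix z assume "z \<in> t_closure R (t_closure R I)"
    then obtain F where F: "finite F" "F \<subseteq> t_closure R I" "z \<in> v_closure R F"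
      unfolding mem_t_closure[OF T] by blast
    then obtain G where "finite G" "G \<subseteq> I" "\<not> G \<subseteq> {0}" "F \<subseteq> v_closure R G"
      using t_closure_finite_subset[OF I nz F(1,2)] by blast
    moreover from this have "z \<in> v_closure R G" using F(3) v_closure_subset[of F G] by blast
    ultimately show "z \<in> t_closure R I" by (intro t_closureI[OF I, of G])
  qed
  with T nzT t_closure_superset[OF T nzT] show ?thesis by (auto simp: t_ideal_def)
qed

lemma t_idealI:
  assumes I: "ideal R I" "I \<noteq> {0}"
    and "\<And>F z. finite F \<Longrightarrow> F \<subseteq> I \<Longrightarrow> \<not> F \<subseteq> {0} \<Longrightarrow> z \<in> v_closure R F \<Longrightarrow> z \<in> I"
  shows "t_ideal R I"
proof -
  have "t_closure R I \<subseteq> I"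
  proof
    fix z assume "z \<in> t_closure R I"
    then show "z \<in> I" unfolding mem_t_closure[OF I(1)] using assms(3) by metis
  qed
  with I t_closure_superset[OF I] show ?thesis by (auto simp: t_ideal_def)
qed

lemma t_idealD:
  assumes "t_ideal R I" "finite F" "F \<subseteq> I" "\<not> F \<subseteq> {0}" "z \<in> v_closure R F"
  shows "z \<in> I"
  using assms(1) t_closureI[OF _ assms(2-5)] by (simp add: t_ideal_def)

lemma t_prime_nonzeroE:
  assumes "t_prime R P"
  obtains a where "a \<in> P" "a \<noteq> 0"
  using assms ideal_nonzeroE[of P] by (auto simp: t_prime_def t_ideal_def)

section \<open>Existence and primality of t-maximal ideals\<close>

lemma ex_t_maximal:
  assumes N: "ideal R N" "N \<noteq> {0}" "1 \<notin> t_closure R N"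
  shows "\<exists>M. t_maximal R M \<and> N \<subseteq> M"
proof -
  \<comment> \<open>Zorn's lemma is applied to ideals whose t-closure omits \<open>1\<close>: a
    finite witness for \<open>1\<close> over the union of a chain already lies in one member. A
    maximal such ideal equals its t-closure, which belongs to the same family.\<close>
  let ?A = "{I. ideal R I \<and> N \<subseteq> I \<and> 1 \<notin> t_closure R I}"
  have "\<exists>M\<in>?A. \<forall>X\<in>?A. M \<subseteq> X \<longrightarrow> X = M"
  proof (rule subset_Zorn_nonempty)
    show "?A \<noteq> {}" using N by blast
  next
    fix C assume C0: "C \<noteq> {}" and C: "subset.chain ?A C"
    have CA: "C \<subseteq> ?A" and lin: "\<And>X Y. X \<in> C \<Longrightarrow> Y \<in> C \<Longrightarrow> X \<subseteq> Y \<or> Y \<subseteq> X"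
      using C by (auto simp: subset_chain_def)
    have U: "ideal R (\<Union>C)"
      unfolding ideal_def
    proof (intro conjI ballI)
      show "\<Union>C \<subseteq> R" using CA by (auto dest: idealD(1))
      show "0 \<in> \<Union>C" using C0 CA by (auto dest: idealD(2))
    next
      fix a b assume "a \<in> \<Union>C" "b \<in> \<Union>C"
      then obtain X where X: "X \<in> C" "a \<in> X" "b \<in> X" using lin by blast
      then have "a + b \<in> X" using CA idealD(3)[of X] by blast
      with X show "a + b \<in> \<Union>C" by blast
    next
      fix r a assume "r \<in> R" "a \<in> \<Union>C"
      then show "r * a \<in> \<Union>C" using CA idealD(4) by blast
    qed
    have "1 \<notin> t_closure R (\<Union>C)"
    proof
      assume "1 \<in> t_closure R (\<Union>C)"
      then obtain F where F: "finite F" "F \<subseteq> \<Union>C" "\<not> F \<subseteq> {0}" "1 \<in> v_closure R F"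
        unfolding mem_t_closure[OF U] by blast
      then obtain X where "X \<in> C" "F \<subseteq> X"
        using finite_subset_Union_chain[OF F(1,2) C0 C] by blast
      with F CA show False using t_closureI[of X F 1] by blast
    qed
    with U C0 CA show "\<Union>C \<in> ?A" by blast
  qed
  then obtain M where MA: "M \<in> ?A" and maxA: "\<forall>X\<in>?A. M \<subseteq> X \<longrightarrow> X = M" by (rule bexE)
  then have M: "ideal R M" "N \<subseteq> M" "1 \<notin> t_closure R M" by auto
  have max: "X = M" if "ideal R X" "1 \<notin> t_closure R X" "M \<subseteq> X" for X
    using that maxA M(2) by auto
  have nz: "M \<noteq> {0}" using N M idealD(2)[OF N(1)] by blast
  note T = t_ideal_t_closure[OF M(1) nz]
  have "t_closure R M = M"
    using T M(3) t_closure_superset[OF M(1) nz] by (intro max) (auto simp: t_ideal_def)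
  with M nz T R_1 have "t_ideal R M" "M \<noteq> R" by auto
  moreover have "X = M" if "t_ideal R X" "X \<noteq> R" "M \<subseteq> X" for X
    using that ideal_eq_R[of X] by (intro max) (auto simp: t_ideal_def)
  ultimately show ?thesis using M(2) unfolding t_maximal_def by blast
qed

text \<open>For \<open>a \<notin> M\<close>, maximality gives \<open>M + Ra\<close> the t-closure
  \<open>R\<close>, so \<open>1\<close> lies in the v-closure of a finite subset \<open>F\<close>.
  If \<open>a * b \<in> M\<close>, multiplication by \<open>b\<close> carries \<open>F\<close> into
  \<open>M\<close> and \<open>1\<close> to \<open>b\<close>.\<close>

lemma t_maximal_prime:
  assumes M: "t_maximal R M" shows "prime_ideal R M"
proof -
  from M have tM: "t_ideal R M" and I: "ideal R M" and nz: "M \<noteq> {0}" and "M \<noteq> R"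
    by (auto simp: t_maximal_def t_ideal_def)
  have "b \<in> M" if ab: "a \<in> R" "b \<in> R" "a * b \<in> M" and a: "a \<notin> M" for a b
  proof -
    define N where "N = {m + r * a | m r. m \<in> M \<and> r \<in> R}"
    have N: "ideal R N"
      unfolding ideal_def
    proof (intro conjI ballI)
      show "N \<subseteq> R" using ab(1) idealD(1)[OF I] R_add R_mult by (auto simp: N_def)
      show "0 \<in> N" using idealD(2)[OF I] R_0 by (force simp: N_def)
    next
      fix x y assume "x \<in> N" "y \<in> N"
      then obtain m r m' r' where "x = m + r * a" "y = m' + r' * a" "m \<in> M" "m' \<in> M" "r \<in> R" "r' \<in> R"
        by (auto simp: N_def)
      then have "x + y = (m + m') + (r + r') * a" "m + m' \<in> M" "r + r' \<in> R"
        using idealD(3)[OF I] R_add by (auto simp: algebra_simps)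
      then show "x + y \<in> N" unfolding N_def by blast
    next
      fix q x assume "x \<in> N" "q \<in> R"
      then obtain m r where "x = m + r * a" "m \<in> M" "r \<in> R" "q \<in> R" by (auto simp: N_def)
      then have "q * x = q * m + (q * r) * a" "q * m \<in> M" "q * r \<in> R"
        using idealD(4)[OF I] R_mult by (simp_all add: distrib_left mult.assoc)
      then show "q * x \<in> N" unfolding N_def by blast
    qed
    have "M \<subseteq> N" using R_0 by (force simp: N_def)
    moreover have "a \<in> N" using R_1 idealD(2)[OF I] unfolding N_def by force
    ultimately have nzN: "N \<noteq> {0}" and aT: "a \<in> t_closure R N" and MT: "M \<subseteq> t_closure R N"
      using nz idealD(2)[OF I] t_closure_superset[OF N] by blast+
    have "t_closure R N = R"
      using M t_ideal_t_closure[OF N nzN] MT aT a unfolding t_maximal_def by metis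
    then have "1 \<in> t_closure R N" by simp
    then obtain F where F: "finite F" "F \<subseteq> N" "\<not> F \<subseteq> {0}" "1 \<in> v_closure R F"
      unfolding mem_t_closure[OF N] by blast
    show "b \<in> M"
    proof (cases "b = 0")
      case True then show ?thesis using idealD(2)[OF I] by simp
    next
      case False
      have "(*) b ` F \<subseteq> M"
      proof safe
        fix f assume "f \<in> F"
        then obtain m r where "f = m + r * a" "m \<in> M" "r \<in> R" using F(2) by (auto simp: N_def)
        moreover have "b * (m + r * a) = b * m + r * (a * b)" by (simp add: algebra_simps)
        ultimately show "b * f \<in> M" using ab idealD(3,4)[OF I] by simp
      qed
      moreover have "\<not> (*) b ` F \<subseteq> {0}" using F(3) False by auto
      moreover have "b \<in> v_closure R ((*) b ` F)" using v_closure_scale[OF F(4), of b] by simp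
      ultimately show ?thesis using F(1) t_idealD[OF tM, of "(*) b ` F" b] by blast
    qed
  qed
  with I \<open>M \<noteq> R\<close> show ?thesis unfolding prime_ideal_def by blast
qed

lemma t_prime_in_t_maximal:
  assumes "t_prime R P" shows "\<exists>M. t_maximal R M \<and> P \<subseteq> M"
  using assms ex_t_maximal[of P] primeD(3) by (auto simp: t_prime_def t_ideal_def)

section \<open>Localizations at primes, in particular those that are valuation domains\<close>

lemma mem_loc: "0 \<in> P \<Longrightarrow> z \<in> loc R P \<longleftrightarrow> (\<exists>s\<in>R. s \<notin> P \<and> s * z \<in> R)"
  unfolding loc_def
proof safe
  fix s assume "0 \<in> P" "s \<in> R" "s \<notin> P" "s * z \<in> R"
  moreover from this have "z = (s * z) / s" by auto
  ultimately show "\<exists>a s. z = a / s \<and> a \<in> R \<and> s \<in> R \<and> s \<notin> P" by metis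
qed force

lemma loc_mono: "P \<subseteq> M \<Longrightarrow> loc R M \<subseteq> loc R P"
  unfolding loc_def by blast

lemma R_subset_loc: "prime_ideal R P \<Longrightarrow> R \<subseteq> loc R P"
  using mem_loc[of P] primeD(2,3) R_1 by (metis mult.left_neutral subsetI)

lemma loc_add:
  assumes P: "prime_ideal R P" and "x \<in> loc R P" "y \<in> loc R P"
  shows "x + y \<in> loc R P"
proof -
  note m = mem_loc[OF primeD(2)[OF P]]
  from assms obtain s t where st: "s \<in> R" "s \<notin> P" "s * x \<in> R" "t \<in> R" "t \<notin> P" "t * y \<in> R"
    unfolding m by blast
  have "(s * t) * (x + y) = t * (s * x) + s * (t * y)" by (simp add: algebra_simps)
  with st show ?thesis unfolding m
    using primeD(5)[OF P] R_mult R_add by (intro bexI[of _ "s * t"]) auto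
qed

lemma loc_mult:
  assumes P: "prime_ideal R P" and "x \<in> loc R P" "y \<in> loc R P"
  shows "x * y \<in> loc R P"
proof -
  note m = mem_loc[OF primeD(2)[OF P]]
  from assms obtain s t where st: "s \<in> R" "s \<notin> P" "s * x \<in> R" "t \<in> R" "t \<notin> P" "t * y \<in> R"
    unfolding m by blast
  have "(s * t) * (x * y) = (s * x) * (t * y)" by (simp add: algebra_simps)
  moreover have "(s * x) * (t * y) \<in> R" "s * t \<in> R" "s * t \<notin> P"
    using st primeD(5)[OF P] R_mult by blast+
  ultimately show ?thesis unfolding m by metis
qed

lemma loc_power: "prime_ideal R P \<Longrightarrow> x \<in> loc R P \<Longrightarrow> x ^ n \<in> loc R P"
  using R_subset_loc[of P] by (induction n) (auto intro: loc_mult)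

lemma loc_common_denominator:
  assumes P: "prime_ideal R P" and "finite F" "F \<subseteq> loc R P"
  shows "\<exists>s\<in>R. s \<notin> P \<and> (\<forall>f\<in>F. s * f \<in> R)"
  using assms(2,3)
proof (induction F)
  case empty
  then show ?case using R_1 primeD(3)[OF P] by blast
next
  case (insert f F)
  then obtain s where s: "s \<in> R" "s \<notin> P" "\<forall>f\<in>F. s * f \<in> R" by auto
  from insert obtain t where t: "t \<in> R" "t \<notin> P" "t * f \<in> R"
    using mem_loc[OF primeD(2)[OF P]] by auto
  have "\<forall>g\<in>insert f F. (s * t) * g \<in> R"
    using s t R_mult by (auto simp: mult.assoc) (metis mult.left_commute R_mult)
  with s t show ?case using primeD(5)[OF P] R_mult by blast
qed

text \<open>Divisibility in a valuation ring is total. The induction keeps the old divisor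
  \<open>j\<close> or replaces it by the new element \<open>f\<close>, whichever divides the
  other.\<close>

lemma finite_loc_generator:
  assumes P: "prime_ideal R P" and V: "valuation_domain (loc R P)"
    and "finite F" "\<not> F \<subseteq> {0}"
  shows "\<exists>j\<in>F. j \<noteq> 0 \<and> (\<forall>f\<in>F. f / j \<in> loc R P)"
  using assms(3,4)
proof (induction F)
  case empty then show ?case by simp
next
  case (insert f F)
  have one: "1 \<in> loc R P" and zero: "0 \<in> loc R P" using R_subset_loc[OF P] by auto
  show ?case
  proof (cases "F \<subseteq> {0}")
    case True
    with insert.prems one zero show ?thesis by (intro bexI[of _ f]) auto
  next
    case False
    then obtain j where j: "j \<in> F" "j \<noteq> 0" "\<forall>g\<in>F. g / j \<in> loc R P" using insert.IH by blast
    show ?thesis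
    proof (cases "f / j \<in> loc R P")
      case True with j show ?thesis by auto
    next
      case False
      then have f: "f \<noteq> 0" using zero by auto
      with False j V have "j / f \<in> loc R P"
        unfolding valuation_domain_def by (metis divide_eq_0_iff inverse_divide)
      then have "g / f \<in> loc R P" if "g \<in> F" for g
        using that j f loc_mult[OF P, of "g / j" "j / f"] by simp
      with f one show ?thesis by (intro bexI[of _ f]) auto
    qed
  qed
qed

text \<open>Every nonzero finitely generated ideal becomes principal in the valuation ring
  \<open>loc R P\<close>, so there its \<open>v\<close>-closure adds nothing.\<close>

lemma v_closure_loc:
  assumes P: "prime_ideal R P" and V: "valuation_domain (loc R P)"
    and F: "finite F" "\<not> F \<subseteq> {0}"
  shows "\<exists>j\<in>F. j \<noteq> 0 \<and> (\<exists>s\<in>R. s \<notin> P \<and> (\<forall>f\<in>F. (s / j) * f \<in> R) \<and>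
    (\<forall>z\<in>v_closure R F. \<exists>r\<in>R. s * z = r * j))"
proof -
  obtain j where j: "j \<in> F" "j \<noteq> 0" "\<forall>f\<in>F. f / j \<in> loc R P"
    using finite_loc_generator[OF assms] by blast
  obtain s where s: "s \<in> R" "s \<notin> P" "\<forall>g\<in>(\<lambda>f. f / j) ` F. s * g \<in> R"
    using loc_common_denominator[OF P, of "(\<lambda>f. f / j) ` F"] F(1) j(3) by blast
  \<comment> \<open>Thus \<open>s / j\<close> lies in \<open>colon R F\<close> and multiplies the
    whole v-closure into \<open>R\<close>; \<open>z * (s / j)\<close> is the required
    \<open>r\<close>.\<close>
  then have 1: "\<forall>f\<in>F. (s / j) * f \<in> R" by simp
  have "\<exists>r\<in>R. s * z = r * j" if "z \<in> v_closure R F" for z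
  proof
    show "z * (s / j) \<in> R" using that 1 unfolding mem_v_closure by blast
    show "s * z = z * (s / j) * j" using j(2) by simp
  qed
  with j s 1 show ?thesis by blast
qed

text \<open>For \<open>z\<close> in the v-closure of a finite \<open>F \<subseteq> P\<close>, some
  \<open>s * z\<close> with \<open>s \<notin> P\<close> is a multiple of an element of
  \<open>F\<close>, and primality gives \<open>z \<in> P\<close>.\<close>

lemma prime_valuation_t_prime:
  assumes P: "prime_ideal R P" "P \<noteq> {0}" and V: "valuation_domain (loc R P)"
  shows "t_prime R P"
  unfolding t_prime_def
proof (intro conjI t_idealI)
  fix F z assume F: "finite F" "F \<subseteq> P" "\<not> F \<subseteq> {0}" and z: "z \<in> v_closure R F"
  have "z \<in> R" using z F(2) v_closure_subset_R[of F] primeD(4)[OF P(1)] by blast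
  moreover obtain j s r where "j \<in> F" "s \<in> R" "s \<notin> P" "r \<in> R" "s * z = r * j"
    using v_closure_loc[OF P(1) V F(1,3)] z by blast
  ultimately show "z \<in> P" using F(2) primeD(5,6)[OF P(1)] by (metis subsetD)
qed (use P primeD in auto)

section \<open>Local-global principles and extensions of ideals to localizations\<close>

lemma in_R_if_locally:
  assumes "\<And>M. t_maximal R M \<Longrightarrow> y \<in> loc R M"
  shows "y \<in> R"
proof (rule ccontr)
  assume y: "y \<notin> R"
  \<comment> \<open>The denominators of \<open>y\<close>. Since \<open>y\<close> multiplies
    \<open>N\<close> into \<open>R\<close>, having \<open>1\<close> in the t-closure of
    \<open>N\<close> would give \<open>y \<in> R\<close>; so \<open>N\<close> lies in a t-maximal
    ideal \<open>M\<close>, contrary to \<open>y \<in> loc R M\<close>.\<close>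
  define N where "N = {r \<in> R. r * y \<in> R}"
  have N: "ideal R N"
    by (auto simp: N_def ideal_def distrib_right mult.assoc intro: R_add R_mult)
  obtain a b where "a \<in> R" "b \<in> R" "b \<noteq> 0" "y = a / b"
    using quot unfolding quotient_field_is_univ_def by blast
  then have "b \<in> N" "b \<noteq> 0" by (simp_all add: N_def)
  then have nz: "N \<noteq> {0}" by blast
  have "1 \<notin> t_closure R N"
  proof
    assume "1 \<in> t_closure R N"
    then obtain F where F: "F \<subseteq> N" "1 \<in> v_closure R F"
      unfolding mem_t_closure[OF N] by blast
    then have "\<forall>f\<in>F. y * f \<in> R" by (auto simp: N_def mult.commute)
    with F(2) y show False by (auto simp: mem_v_closure)
  qed
  then obtain M where M: "t_maximal R M" "N \<subseteq> M" using ex_t_maximal[OF N nz] by blast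
  with assms[OF M(1)] show False
    using mem_loc[OF primeD(2)[OF t_maximal_prime[OF M(1)]]] by (auto simp: N_def)
qed

text \<open>The multipliers of \<open>x\<close> into \<open>A\<close> form an ideal inside no
  t-maximal ideal, so its t-closure contains \<open>1\<close>. Scaling a finite witness by
  \<open>x \<noteq> 0\<close> gives a nonzero witness for \<open>x\<close> inside
  \<open>A\<close>.\<close>

lemma in_t_closure_if_locally:
  assumes A: "ideal R A" "A \<noteq> {0}" and x: "x \<in> R"
    and loc: "\<And>M. t_maximal R M \<Longrightarrow> \<exists>s\<in>R. s \<notin> M \<and> s * x \<in> A"
  shows "x \<in> t_closure R A"
proof (cases "x = 0")
  case True
  then show ?thesis using t_closure_superset[OF A] idealD(2)[OF A(1)] by blast
next
  case False
  define N where "N = {r \<in> R. r * x \<in> A}"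
  have N: "ideal R N"
    using idealD[OF A(1)]
    by (auto simp: N_def ideal_def distrib_right mult.assoc intro: R_add R_mult)
  have "A \<subseteq> N" using idealD(1,4)[OF A(1)] x by (auto simp: N_def mult.commute[of _ x])
  then have nz: "N \<noteq> {0}" using A idealD(2) by blast
  have "1 \<in> t_closure R N"
  proof (rule ccontr)
    assume "1 \<notin> t_closure R N"
    then obtain M where M: "t_maximal R M" "N \<subseteq> M" using ex_t_maximal[OF N nz] by blast
    with loc[OF M(1)] show False by (auto simp: N_def)
  qed
  then obtain F where F: "finite F" "F \<subseteq> N" "\<not> F \<subseteq> {0}" "1 \<in> v_closure R F"
    unfolding mem_t_closure[OF N] by blast
  have "x \<in> v_closure R ((*) x ` F)" using v_closure_scale[OF F(4), of x] by simp
  moreover have "(*) x ` F \<subseteq> A" using F(2) by (auto simp: N_def mult.commute)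
  moreover have "\<not> (*) x ` F \<subseteq> {0}" using F(3) False by auto
  ultimately show ?thesis using F(1) t_closureI[OF A(1), of "(*) x ` F" x] by blast
qed

text \<open>The extension of an ideal \<open>A\<close> to the localization at a prime
  \<open>P\<close>. In particular \<open>loc_ideal P P\<close> is the maximal ideal of
  \<open>loc R P\<close>.\<close>

definition loc_ideal :: "'k set \<Rightarrow> 'k set \<Rightarrow> 'k set" where
  "loc_ideal A P = {z. \<exists>s\<in>R. s \<notin> P \<and> s * z \<in> A}"

lemma loc_ideal_mult:
  assumes P: "prime_ideal R P" and A: "ideal R A" and "z \<in> loc_ideal A P" "w \<in> loc R P"
  shows "z * w \<in> loc_ideal A P"
proof -
  from assms obtain s t where st: "s \<in> R" "s \<notin> P" "s * z \<in> A" "t \<in> R" "t \<notin> P" "t * w \<in> R"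
    unfolding loc_ideal_def mem_loc[OF primeD(2)[OF P]] by blast
  have "(s * t) * (z * w) = (t * w) * (s * z)" by (simp add: algebra_simps)
  moreover have "(t * w) * (s * z) \<in> A" using st idealD(4)[OF A] by blast
  moreover have "s * t \<in> R" "s * t \<notin> P" using st primeD(5)[OF P] R_mult by blast+
  ultimately show ?thesis unfolding loc_ideal_def mem_Collect_eq by metis
qed

lemma loc_ideal_superset: "prime_ideal R P \<Longrightarrow> A \<subseteq> loc_ideal A P"
  using primeD(3) unfolding loc_ideal_def by (force intro: bexI[of _ 1])

lemma one_notin_loc_ideal: "prime_ideal R P \<Longrightarrow> 1 \<notin> loc_ideal P P"
  by (auto simp: loc_ideal_def)

text \<open>\<open>z\<close> ranges over the whole field: outside \<open>loc R P\<close> the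
  valuation property supplies the inverse, and inside it an element off the maximal ideal is a
  unit.\<close>

lemma inverse_in_loc:
  assumes P: "prime_ideal R P" and V: "valuation_domain (loc R P)" and z: "z \<notin> loc_ideal P P"
  shows "z \<noteq> 0" and "inverse z \<in> loc R P"
proof -
  note m = mem_loc[OF primeD(2)[OF P]]
  show nz: "z \<noteq> 0" using z loc_ideal_superset[OF P, of P] primeD(2)[OF P] by blast
  show "inverse z \<in> loc R P"
  proof (rule ccontr)
    assume n: "inverse z \<notin> loc R P"
    then have "z \<in> loc R P" using V nz unfolding valuation_domain_def by blast
    then obtain s where s: "s \<in> R" "s \<notin> P" "s * z \<in> R" unfolding m by blast
    with z have "s * z \<notin> P" unfolding loc_ideal_def by blast
    with s n nz show False unfolding m by (metis mult.assoc mult.right_neutral right_inverse)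
  qed
qed

lemma t_closure_loc_ideal:
  assumes A: "ideal R A" and P: "prime_ideal R P" and V: "valuation_domain (loc R P)"
    and z: "z \<in> t_closure R A"
  shows "z \<in> loc_ideal A P"
proof -
  obtain F where F: "finite F" "F \<subseteq> A" "\<not> F \<subseteq> {0}" "z \<in> v_closure R F"
    using z unfolding mem_t_closure[OF A] by blast
  obtain j s r where "j \<in> F" "s \<in> R" "s \<notin> P" "r \<in> R" "s * z = r * j"
    using v_closure_loc[OF P V F(1,3)] F(4) by blast
  then show ?thesis using F(2) idealD(4)[OF A] unfolding loc_ideal_def by fastforce
qed

text \<open>A \<open>P\<close>-primary ideal is the contraction of its extension to
  \<open>loc R P\<close>, and that extension already contains the t-closure.\<close>

lemma t_closure_primary:
  assumes Q: "primary_for R P Q" and P: "prime_ideal R P" and V: "valuation_domain (loc R P)"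
  shows "t_closure R Q \<subseteq> Q"
proof
  fix z assume z: "z \<in> t_closure R Q"
  have I: "ideal R Q" using Q by (simp add: primary_for_def)
  obtain s where s: "s \<in> R" "s \<notin> P" "s * z \<in> Q"
    using t_closure_loc_ideal[OF I P V z] unfolding loc_ideal_def by blast
  have "z \<in> R"
    using z v_closure_subset_R idealD(1)[OF I] unfolding mem_t_closure[OF I] by blast
  then show "z \<in> Q" using s Q unfolding primary_for_def by (metis mult.commute)
qed

section \<open>The trace ideal \<open>I(R : I)\<close> and its local divisors\<close>

definition trace :: "'k set \<Rightarrow> 'k set" where
  "trace I = submod_prod I (colon R I)"

lemma trace_mult: "i \<in> I \<Longrightarrow> u \<in> colon R I \<Longrightarrow> i * u \<in> trace I"
  unfolding trace_def submod_prod_def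
  by (rule CollectI, rule exI[of _ 1], rule exI[of _ "\<lambda>_. i"], rule exI[of _ "\<lambda>_. u"]) simp

lemma traceE:
  assumes "z \<in> trace I"
  obtains n a b where "z = (\<Sum>k<(n::nat). a k * b k)" "\<And>k. k < n \<Longrightarrow> a k \<in> I"
    "\<And>k. k < n \<Longrightarrow> b k \<in> colon R I"
proof -
  from assms obtain n a b where "z = (\<Sum>k<(n::nat). a k * b k)" "\<forall>k<n. a k \<in> I \<and> b k \<in> colon R I"
    unfolding trace_def submod_prod_def by blast
  then show thesis using that[of a b n] by simp
qed

lemma ideal_trace:
  assumes I: "ideal R I" shows "ideal R (trace I)"
  unfolding ideal_def
proof (intro conjI ballI)
  show "trace I \<subseteq> R"
  proof
    fix z assume "z \<in> trace I"
    then obtain n a b where "z = (\<Sum>k<(n::nat). a k * b k)" "\<And>k. k < n \<Longrightarrow> a k \<in> I"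
      "\<And>k. k < n \<Longrightarrow> b k \<in> colon R I" by (rule traceE) blast
    then show "z \<in> R" by (auto simp: colon_def mult.commute intro!: R_sum)
  qed
  show "0 \<in> trace I"
    unfolding trace_def submod_prod_def by (rule CollectI, rule exI[of _ 0]) simp
next
  fix x y assume "x \<in> trace I" "y \<in> trace I"
  then obtain n a b m a' b' where
    x: "x = (\<Sum>k<(n::nat). a k * b k)" "\<And>k. k < n \<Longrightarrow> a k \<in> I" "\<And>k. k < n \<Longrightarrow> b k \<in> colon R I" and
    y: "y = (\<Sum>k<(m::nat). a' k * b' k)" "\<And>k. k < m \<Longrightarrow> a' k \<in> I" "\<And>k. k < m \<Longrightarrow> b' k \<in> colon R I"
    by (elim traceE) blast
  define c where "c k = (if k < n then a k else a' (k - n))" for k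
  define d where "d k = (if k < n then b k else b' (k - n))" for k
  have "(\<Sum>k<n + l. c k * d k) = x + (\<Sum>k<l. a' k * b' k)" for l
    by (induction l) (simp_all add: x(1) c_def d_def)
  then have "x + y = (\<Sum>k<n + m. c k * d k)" by (simp add: y(1))
  moreover have "\<forall>k<n + m. c k \<in> I \<and> d k \<in> colon R I" using x y by (auto simp: c_def d_def)
  ultimately show "x + y \<in> trace I" unfolding trace_def submod_prod_def by blast
next
  fix r x assume r: "r \<in> R" and "x \<in> trace I"
  then obtain n a b where
    x: "x = (\<Sum>k<(n::nat). a k * b k)" "\<And>k. k < n \<Longrightarrow> a k \<in> I" "\<And>k. k < n \<Longrightarrow> b k \<in> colon R I"
    by (elim traceE) blast
  have "r * x = (\<Sum>k<n. (r * a k) * b k)" by (simp add: x(1) sum_distrib_left mult.assoc)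
  moreover have "\<forall>k<n. r * a k \<in> I \<and> b k \<in> colon R I" using x r idealD(4)[OF I] by blast
  ultimately show "r * x \<in> trace I" unfolding trace_def submod_prod_def
    by (intro CollectI exI[of _ n] exI[of _ "\<lambda>k. r * a k"] exI[of _ b]) simp
qed

lemma subset_trace:
  assumes I: "ideal R I" shows "I \<subseteq> trace I"
proof
  fix i assume "i \<in> I"
  moreover have "1 \<in> colon R I" using idealD(1)[OF I] by (simp add: colon_def)
  ultimately show "i \<in> trace I" using trace_mult[of i I 1] by simp
qed

text \<open>Among the finitely many terms of a sum representing \<open>z\<close>, one divides all
  others in the valuation ring and hence divides \<open>z\<close>.\<close>

lemma trace_loc_generator:
  assumes P: "prime_ideal R P" and V: "valuation_domain (loc R P)"
    and z: "z \<in> trace I" "z \<noteq> 0"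
  shows "\<exists>i\<in>I. \<exists>u\<in>colon R I. i * u \<noteq> 0 \<and> z / (i * u) \<in> loc R P"
proof -
  from z(1) obtain n a b where
    x: "z = (\<Sum>k<(n::nat). a k * b k)" "\<And>k. k < n \<Longrightarrow> a k \<in> I" "\<And>k. k < n \<Longrightarrow> b k \<in> colon R I"
    by (elim traceE) blast
  let ?F = "(\<lambda>k. a k * b k) ` {..<n}"
  have "\<not> ?F \<subseteq> {0}"
  proof
    assume "?F \<subseteq> {0}"
    then have "z = 0" unfolding x(1) by (intro sum.neutral) auto
    with z(2) show False by simp
  qed
  then obtain j where j: "j \<in> ?F" "j \<noteq> 0" "\<forall>f\<in>?F. f / j \<in> loc R P"
    using finite_loc_generator[OF P V, of ?F] by blast
  have zero: "0 \<in> loc R P" using R_subset_loc[OF P] R_0 by blast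
  have sum: "(\<Sum>k\<in>K. f k) \<in> loc R P" if "\<And>k. k \<in> K \<Longrightarrow> f k \<in> loc R P" for K :: "nat set" and f
    using that zero by (induction K rule: infinite_finite_induct) (auto intro: loc_add[OF P])
  have "z / j = (\<Sum>k<n. a k * b k / j)" unfolding x(1) by (rule sum_divide_distrib)
  also have "\<dots> \<in> loc R P" using j(3) by (intro sum) auto
  finally show ?thesis using j x(2,3) by blast
qed

end

section \<open>Primes below a t-maximal ideal of a PvMD\<close>

locale pvmd = frac_domain R for R :: "'k::field set" +
  assumes pvmd: "PvMD R"
begin

lemma loc_valuation:
  assumes "t_maximal R M" "P \<subseteq> M" shows "valuation_domain (loc R P)"
  using assms pvmd loc_mono[of P M] unfolding PvMD_def valuation_domain_def by blast

lemma t_prime_valuation: "t_prime R P \<Longrightarrow> valuation_domain (loc R P)"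
  using t_prime_in_t_maximal loc_valuation by blast

text \<open>These primes correspond to primes of the valuation ring \<open>loc R M\<close>: for
  \<open>a \<in> P - Q\<close> and \<open>b \<in> Q - P\<close>, one of \<open>a / b\<close>,
  \<open>b / a\<close> lies in \<open>loc R M\<close>, which forces \<open>a \<in> Q\<close> or
  \<open>b \<in> P\<close>.\<close>

lemma primes_comparable:
  assumes M: "t_maximal R M" and P: "prime_ideal R P" "P \<subseteq> M" and Q: "prime_ideal R Q" "Q \<subseteq> M"
  shows "P \<subseteq> Q \<or> Q \<subseteq> P"
proof (rule ccontr)
  assume "\<not> (P \<subseteq> Q \<or> Q \<subseteq> P)"
  then obtain a b where ab: "a \<in> P" "a \<notin> Q" "b \<in> Q" "b \<notin> P" by blast
  then have nz: "a \<noteq> 0" "b \<noteq> 0" using primeD(2) P Q by blast+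
  have *: False if that: "p \<in> X" "p \<notin> Y" "q \<in> Y" "q \<noteq> 0" "prime_ideal R X" "prime_ideal R Y" "Y \<subseteq> M"
    and pq: "p / q \<in> loc R M" for p q X Y
  proof -
    obtain s where s: "s \<in> R" "s \<notin> M" "s * (p / q) \<in> R"
      using pq mem_loc[OF primeD(2)[OF t_maximal_prime[OF M]]] by blast
    have "s * p = (s * (p / q)) * q" using that(4) by simp
    then have "s * p \<in> Y" using s(3) that(3) primeD(6)[OF that(6)] by metis
    then show False using s that primeD(4)[OF that(5)] primeD(5)[OF that(6)] by blast
  qed
  have "a / b \<in> loc R M \<or> b / a \<in> loc R M"
    using loc_valuation[OF M order_refl] nz unfolding valuation_domain_def
    by (metis divide_eq_0_iff inverse_divide)
  then show False using *[of a P Q b] *[of b Q P a] ab nz P Q by blast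
qed

text \<open>A prime of a valuation ring does not grow when the ring is localized at it. If
  \<open>z \<notin> loc R M\<close>, then \<open>inverse z\<close> has a denominator
  \<open>t \<notin> M\<close>, and \<open>s * z \<in> P\<close> gives \<open>t * s \<in> P\<close>
  with both factors outside \<open>P\<close>.\<close>

lemma maximal_ideal_loc:
  assumes P: "prime_ideal R P" and M: "t_maximal R M" "P \<subseteq> M" and z: "z \<in> loc_ideal P P"
  shows "z \<in> loc R M"
proof (rule ccontr)
  note m = mem_loc[OF primeD(2)[OF t_maximal_prime[OF M(1)]]]
  assume n: "z \<notin> loc R M"
  then have nz: "z \<noteq> 0" using R_subset_loc[OF t_maximal_prime[OF M(1)]] R_0 by blast
  then have "inverse z \<in> loc R M"
    using n loc_valuation[OF M(1) order_refl] unfolding valuation_domain_def by blast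
  then obtain t where t: "t \<in> R" "t \<notin> M" "t * inverse z \<in> R" unfolding m by blast
  obtain s where s: "s \<in> R" "s \<notin> P" "s * z \<in> P" using z unfolding loc_ideal_def by blast
  have "(t * inverse z) * (s * z) = t * s" using nz by simp
  then have "t * s \<in> P" using primeD(6)[OF P t(3) s(3)] by metis
  then show False using s t M(2) primeD(5)[OF P t(1) s(1)] by blast
qed

section \<open>Sharp t-primes and the t## property\<close>

definition t_sharp_prime :: "'k set \<Rightarrow> bool" where
  "t_sharp_prime P \<longleftrightarrow>
    (\<exists>G. finite G \<and> G \<subseteq> P \<and> (\<forall>M. t_maximal R M \<and> G \<subseteq> M \<longrightarrow> P \<subseteq> M))"

text \<open>\<open>B\<close> is the conductor \<open>(R : (1, y))\<close>, contained in
  \<open>P\<close>, and \<open>N\<close> is its product with \<open>(1, y)\<close>. As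
  \<open>(1, y)\<close> is locally principal, \<open>1\<close> lies in the t-closure of
  \<open>N\<close>; the coefficients in \<open>B\<close> of a finite witness form the set required
  for sharpness.\<close>

lemma t_sharp_primeI:
  assumes P: "prime_ideal R P" and y: "y \<notin> loc R P"
    and yM: "\<And>M. t_maximal R M \<Longrightarrow> \<not> P \<subseteq> M \<Longrightarrow> y \<in> loc R M"
  shows "t_sharp_prime P"
proof -
  define B where "B = {r \<in> R. r * y \<in> R}"
  have BP: "B \<subseteq> P" using y unfolding mem_loc[OF primeD(2)[OF P]] B_def by blast
  have B: "ideal R B"
    by (auto simp: B_def ideal_def distrib_right mult.assoc intro: R_add R_mult)
  define N where "N = {b + c * y | b c. b \<in> B \<and> c \<in> B}"
  have N: "ideal R N"
    unfolding ideal_def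
  proof (intro conjI ballI)
    show "N \<subseteq> R" unfolding N_def B_def using R_add by auto
    show "0 \<in> N" unfolding N_def using idealD(2)[OF B] by force
  next
    fix f g assume "f \<in> N" "g \<in> N"
    then obtain b c b' c' where "f = b + c * y" "g = b' + c' * y" "b \<in> B" "c \<in> B" "b' \<in> B" "c' \<in> B"
      unfolding N_def by blast
    then have "f + g = (b + b') + (c + c') * y" "b + b' \<in> B" "c + c' \<in> B"
      using idealD(3)[OF B] by (simp_all add: algebra_simps)
    then show "f + g \<in> N" unfolding N_def by blast
  next
    fix r f assume "r \<in> R" "f \<in> N"
    then obtain b c where "f = b + c * y" "b \<in> B" "c \<in> B" "r \<in> R" unfolding N_def by blast
    then have "r * f = r * b + (r * c) * y" "r * b \<in> B" "r * c \<in> B"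
      using idealD(4)[OF B] by (simp_all add: distrib_left mult.assoc)
    then show "r * f \<in> N" unfolding N_def by blast
  qed
  have BN: "b \<in> N" if "b \<in> B" for b unfolding N_def using that idealD(2)[OF B] by force
  have ByN: "b * y \<in> N" if "b \<in> B" for b unfolding N_def using that idealD(2)[OF B] by force
  obtain a b where "a \<in> R" "b \<in> R" "b \<noteq> 0" "y = a / b"
    using quot unfolding quotient_field_is_univ_def by blast
  then have "b \<in> B" "b \<noteq> 0" by (simp_all add: B_def)
  then have nz: "N \<noteq> {0}" using BN by blast
  have "1 \<in> t_closure R N"
  proof (rule ccontr)
    assume "1 \<notin> t_closure R N"
    then obtain M where M: "t_maximal R M" "N \<subseteq> M" using ex_t_maximal[OF N nz] by blast
    \<comment> \<open>Over \<open>loc R M\<close> the module \<open>(1, y)\<close> is generated by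
      \<open>j\<close>. Then \<open>s / j\<close> lies in \<open>B\<close>, and
      \<open>s = (s / j) * j\<close> is an element of \<open>N\<close> outside
      \<open>M\<close>.\<close>
    have "finite {1, y}" "\<not> {1, y} \<subseteq> {0}" by simp_all
    then obtain j s where
      js: "j \<in> {1, y}" "j \<noteq> 0" "s \<in> R" "s \<notin> M" "\<forall>f\<in>{1, y}. (s / j) * f \<in> R"
      using v_closure_loc[OF t_maximal_prime[OF M(1)] loc_valuation[OF M(1) order_refl]] by metis
    then have "s / j \<in> B" by (simp add: B_def)
    then have "s / j * 1 \<in> N" "s / j * y \<in> N" using BN[of "s / j"] ByN[of "s / j"] by simp_all
    then have "s / j * j \<in> N" using js(1) by blast
    with js M(2) show False by auto
  qed
  then obtain F where F: "finite F" "F \<subseteq> N" "\<not> F \<subseteq> {0}" "1 \<in> v_closure R F"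
    unfolding mem_t_closure[OF N] by blast
  have "\<forall>f\<in>F. \<exists>b c. f = b + c * y \<and> b \<in> B \<and> c \<in> B" using F(2) unfolding N_def by blast
  then obtain b c where bc: "\<And>f. f \<in> F \<Longrightarrow> f = b f + c f * y \<and> b f \<in> B \<and> c f \<in> B" by metis
  \<comment> \<open>If \<open>P\<close> were not inside \<open>M\<close>, then \<open>y\<close>
    would have a denominator \<open>s \<notin> M\<close>, and coefficients in \<open>M\<close> would
    put \<open>F\<close>, hence \<open>1\<close>, into \<open>M\<close>.\<close>
  have "P \<subseteq> M" if M: "t_maximal R M" and GM: "b ` F \<union> c ` F \<subseteq> M" for M
  proof (rule ccontr)
    note pM = t_maximal_prime[OF M]
    assume "\<not> P \<subseteq> M"
    then obtain s where s: "s \<in> R" "s \<notin> M" "s * y \<in> R"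
      using yM[OF M] mem_loc[OF primeD(2)[OF pM]] by blast
    have "F \<subseteq> M"
    proof
      fix f assume f: "f \<in> F"
      have "s * f = s * b f + (s * y) * c f" using bc[OF f] by (metis distrib_left mult.assoc mult.commute)
      moreover have "b f \<in> M" "c f \<in> M" using GM f by auto
      ultimately have "s * f \<in> M"
        using s idealD(3)[OF primeD(1)[OF pM]] primeD(6)[OF pM] by simp
      moreover have "f \<in> R" using f F(2) idealD(1)[OF N] by blast
      ultimately show "f \<in> M" using s primeD(5)[OF pM] by blast
    qed
    then have "1 \<in> M" using t_idealD[OF _ F(1) _ F(3,4)] M unfolding t_maximal_def by blast
    with primeD(3)[OF pM] show False by simp
  qed
  moreover have "finite (b ` F \<union> c ` F)" "b ` F \<union> c ` F \<subseteq> P" using F(1) bc BP by auto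
  ultimately show ?thesis unfolding t_sharp_prime_def by (intro exI[of _ "b ` F \<union> c ` F"]) simp
qed

lemma t_maximal_t_prime: "t_maximal R M \<Longrightarrow> t_prime R M"
  using t_maximal_prime by (auto simp: t_prime_def t_maximal_def)

text \<open>The t-maximal ideals not containing \<open>P\<close> are compared with the same family
  enlarged by \<open>P\<close>. The distinct intersections yield an element \<open>y\<close> for
  \<open>t_sharp_primeI\<close>.\<close>

lemma t_sharp_sharp_imp_sharp:
  assumes sh: "t_sharp_sharp R" and P: "t_prime R P"
  shows "t_sharp_prime P"
proof -
  define S where "S = {M. t_maximal R M \<and> \<not> P \<subseteq> M}"
  have Pp: "prime_ideal R P" using P by (simp add: t_prime_def)
  have max: "M = Q" if "t_maximal R M" "t_prime R Q" "M \<subseteq> Q" for M Q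
    using that unfolding t_maximal_def t_prime_def prime_ideal_def by blast
  have "pairwise_incomparable S" "pairwise_incomparable (insert P S)"
    unfolding pairwise_incomparable_def S_def using max P t_maximal_t_prime by blast+
  moreover have "\<forall>Q\<in>S. t_prime R Q" "\<forall>Q\<in>insert P S. t_prime R Q"
    using P t_maximal_t_prime by (auto simp: S_def)
  moreover have "S \<noteq> insert P S" by (auto simp: S_def)
  ultimately have "(\<Inter>Q\<in>S. loc R Q) \<noteq> (\<Inter>Q\<in>insert P S. loc R Q)"
    using sh unfolding t_sharp_sharp_def by metis
  then obtain y where "y \<in> (\<Inter>Q\<in>S. loc R Q)" "y \<notin> loc R P" by auto
  then show ?thesis by (intro t_sharp_primeI[OF Pp, of y]) (auto simp: S_def)
qed

text \<open>If no member of \<open>S\<close> contains \<open>P\<close>, then every finite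
  \<open>H \<subseteq> P\<close> containing \<open>G\<close> and \<open>p\<close> lies in a member
  of \<open>S\<close> strictly below \<open>P\<close>. Two choices of \<open>H\<close> yield
  distinct members, comparable because they lie below one t-maximal ideal.\<close>

lemma sharp_prime_subset:
  assumes P: "t_prime R P" "t_sharp_prime P"
    and S: "\<forall>Q\<in>S. t_prime R Q" "pairwise_incomparable S"
    and sub: "(\<Inter>Q\<in>S. loc R Q) \<subseteq> loc R P"
  shows "\<exists>Q\<in>S. P \<subseteq> Q"
proof (rule ccontr)
  assume no: "\<not> (\<exists>Q\<in>S. P \<subseteq> Q)"
  have Pp: "prime_ideal R P" using P by (simp add: t_prime_def)
  obtain M where M: "t_maximal R M" "P \<subseteq> M" using t_prime_in_t_maximal[OF P(1)] by blast
  obtain p where p: "p \<in> P" "p \<noteq> 0" using P(1) by (rule t_prime_nonzeroE)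
  obtain G where G: "finite G" "G \<subseteq> P" "\<forall>M. t_maximal R M \<and> G \<subseteq> M \<longrightarrow> P \<subseteq> M"
    using P(2) unfolding t_sharp_prime_def by (elim exE conjE)
  have *: "\<exists>Q\<in>S. Q \<subseteq> P \<and> H \<subseteq> Q" if H: "finite H" "H \<subseteq> P" "G \<subseteq> H" "p \<in> H" for H
  proof -
    \<comment> \<open>The fraction \<open>s / j\<close> is not in \<open>loc R P\<close>, as
      \<open>j \<in> P\<close> and \<open>s \<notin> P\<close>, but every element of
      \<open>H\<close> is a denominator for it; so a \<open>Q\<close> whose localization omits it
      must contain \<open>H\<close>. The element \<open>p\<close> keeps \<open>H\<close>
      nonzero.\<close>
    obtain j s where js: "j \<in> H" "j \<noteq> 0" "s \<in> R" "s \<notin> P" "\<forall>f\<in>H. (s / j) * f \<in> R"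
      using v_closure_loc[OF Pp t_prime_valuation[OF P(1)], of H] H p by blast
    have "s / j \<notin> loc R P"
    proof
      assume "s / j \<in> loc R P"
      then obtain t where t: "t \<in> R" "t \<notin> P" "t * (s / j) \<in> R"
        unfolding mem_loc[OF primeD(2)[OF Pp]] by blast
      have "t * s = (t * (s / j)) * j" using js(2) by simp
      then have "t * s \<in> P" using primeD(6)[OF Pp t(3), of j] js(1) H(2) by auto
      then show False using t js primeD(5)[OF Pp] by blast
    qed
    then obtain Q where Q: "Q \<in> S" "s / j \<notin> loc R Q" using sub by blast
    have Qt: "t_prime R Q" and Qp: "prime_ideal R Q" using Q S by (auto simp: t_prime_def)
    have HQ: "H \<subseteq> Q"
    proof
      fix h assume h: "h \<in> H"
      show "h \<in> Q"
      proof (rule ccontr)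
        assume "h \<notin> Q"
        moreover have "h \<in> R" using h H(2) primeD(4)[OF Pp] by blast
        moreover have "h * (s / j) \<in> R" using js(5) h by (metis mult.commute)
        ultimately show False using Q(2) unfolding mem_loc[OF primeD(2)[OF Qp]] by blast
      qed
    qed
    obtain M' where M': "t_maximal R M'" "Q \<subseteq> M'" using t_prime_in_t_maximal[OF Qt] by blast
    then have "P \<subseteq> M'" using G(3) H(3) HQ by blast
    then have "Q \<subseteq> P" using primes_comparable[OF M'(1) Pp _ Qp M'(2)] no Q(1) by blast
    with Q(1) HQ show ?thesis by blast
  qed
  obtain Q1 where Q1: "Q1 \<in> S" "Q1 \<subseteq> P" "insert p G \<subseteq> Q1"
    using *[of "insert p G"] G p by blast
  then obtain b where b: "b \<in> P" "b \<notin> Q1" using no by blast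
  obtain Q2 where Q2: "Q2 \<in> S" "Q2 \<subseteq> P" "insert b (insert p G) \<subseteq> Q2"
    using *[of "insert b (insert p G)"] G p b by blast
  have "Q1 \<subseteq> Q2 \<or> Q2 \<subseteq> Q1"
    using primes_comparable[OF M(1), of Q1 Q2] Q1 Q2 M(2) S(1) unfolding t_prime_def by blast
  then have "Q1 = Q2" using S(2) Q1(1) Q2(1) unfolding pairwise_incomparable_def by blast
  with b Q2 show False by blast
qed

text \<open>A member \<open>P\<close> of one family lies in some \<open>Q\<close> of the other, and
  \<open>Q\<close> in some \<open>P'\<close> of the first; incomparability collapses the chain to
  \<open>P = Q\<close>.\<close>

lemma sharp_imp_t_sharp_sharp:
  assumes sh: "\<And>P. t_prime R P \<Longrightarrow> t_sharp_prime P"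
  shows "t_sharp_sharp R"
proof -
  have sub: "S1 \<subseteq> S2"
    if S1: "\<forall>P\<in>S1. t_prime R P" "pairwise_incomparable S1"
      and S2: "\<forall>P\<in>S2. t_prime R P" "pairwise_incomparable S2"
      and eq: "(\<Inter>P\<in>S1. loc R P) = (\<Inter>P\<in>S2. loc R P)" for S1 S2
  proof
    fix P assume P: "P \<in> S1"
    then have tP: "t_prime R P" and "(\<Inter>P\<in>S2. loc R P) \<subseteq> loc R P" using S1(1) eq by auto
    then obtain Q where Q: "Q \<in> S2" "P \<subseteq> Q"
      using sharp_prime_subset[OF tP sh[OF tP] S2] by metis
    then have tQ: "t_prime R Q" and "(\<Inter>P\<in>S1. loc R P) \<subseteq> loc R Q" using S2(1) eq by auto
    then obtain P' where P': "P' \<in> S1" "Q \<subseteq> P'"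
      using sharp_prime_subset[OF tQ sh[OF tQ] S1] by metis
    have "P \<subseteq> P'" using Q(2) P'(2) by (rule order_trans)
    then have "P = P'" using S1(2) P P'(1) unfolding pairwise_incomparable_def by simp
    then have "P = Q" using Q(2) P'(2) by simp
    with Q(1) show "P \<in> S2" by simp
  qed
  show ?thesis unfolding t_sharp_sharp_def
  proof (intro allI impI notI)
    fix S1 S2
    assume "(\<forall>P\<in>S1. t_prime R P) \<and> (\<forall>P\<in>S2. t_prime R P) \<and>
      pairwise_incomparable S1 \<and> pairwise_incomparable S2 \<and> S1 \<noteq> S2"
      and "(\<Inter>P\<in>S1. loc R P) = (\<Inter>P\<in>S2. loc R P)"
    then show False using sub[of S1 S2] sub[of S2 S1] by auto
  qed
qed

section \<open>From sharpness to radical trace ideals\<close>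

lemma trace_locally_radical:
  assumes sharp: "\<And>P. t_prime R P \<Longrightarrow> t_sharp_prime P"
    and I: "ideal R I" and M: "t_maximal R M"
    and x: "x \<in> R" "x ^ n \<in> loc_ideal (trace I) M"
  shows "x \<in> loc_ideal (trace I) M"
proof (rule ccontr)
  assume xn: "x \<notin> loc_ideal (trace I) M"
  define A where "A = loc_ideal (trace I) M"
  note pM = t_maximal_prime[OF M] and V = loc_valuation[OF M order_refl]
  note mM = mem_loc[OF primeD(2)[OF pM]]
  have Amult: "z * w \<in> A" if "z \<in> A" "w \<in> loc R M" for z w
    using that loc_ideal_mult[OF pM ideal_trace[OF I]] unfolding A_def by blast
  have trA: "trace I \<subseteq> A" unfolding A_def by (rule loc_ideal_superset[OF pM])
  have RV: "R \<subseteq> loc R M" by (rule R_subset_loc[OF pM])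
  have xA: "x \<notin> A" using xn by (simp add: A_def)
  have zA: "0 \<in> A" using trA idealD(2)[OF ideal_trace[OF I]] by blast
  have x0: "x \<noteq> 0" using xA zA by auto
  have oneA: "1 \<notin> A" using xA Amult[of 1 x] x(1) RV by auto
  \<comment> \<open>Total divisibility in \<open>loc R M\<close>, stated with products so that it
    covers zero.\<close>
  have cmp: "\<exists>v\<in>loc R M. a = b * v \<or> b = a * v" for a b
  proof (cases "a = 0 \<or> b = 0")
    case True
    then show ?thesis using RV R_0 by (metis mult_zero_right subsetD)
  next
    case False
    then have "a / b \<in> loc R M \<or> b / a \<in> loc R M"
      using V unfolding valuation_domain_def by (metis divide_eq_0_iff inverse_divide)
    with False show ?thesis by (metis nonzero_mult_div_cancel_left times_divide_eq_right)
  qed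
  have Ax: "\<exists>v\<in>loc R M. z = x * v" if "z \<in> A" for z
    using cmp[of z x] Amult[OF that] xA by metis

  \<comment> \<open>The radical of \<open>A\<close>, contracted to \<open>R\<close>. It is prime by
    \<open>cmp\<close>: for \<open>a = b * v\<close> the square of \<open>a\<close> is
    \<open>a * b * v\<close>, and \<open>a + b\<close> is a multiple of \<open>b\<close>.\<close>
  define P where "P = {r \<in> R. \<exists>m. r ^ m \<in> A}"
  have PI: "r \<in> P" if "r \<in> R" "r ^ m \<in> A" for r m using that unfolding P_def by blast
  have vpow: "v ^ m \<in> loc R M" if "v \<in> loc R M" for v m using loc_power[OF pM that] .
  have P: "prime_ideal R P"
    unfolding prime_ideal_def ideal_def
  proof (intro conjI ballI impI)
    show "P \<subseteq> R" unfolding P_def by blast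
    show "0 \<in> P" using PI[of 0 1] zA by simp
    show "P \<noteq> R"
    proof
      assume "P = R"
      then have "1 \<in> P" by simp
      then show False using oneA by (simp add: P_def)
    qed
  next
    fix a b assume "a \<in> P" "b \<in> P"
    then obtain k l where ab: "a \<in> R" "b \<in> R" "a ^ k \<in> A" "b ^ l \<in> A" unfolding P_def by blast
    from cmp[of a b] obtain v where v: "v \<in> loc R M" "a = b * v \<or> b = a * v" by blast
    have w: "1 + v \<in> loc R M" "v + 1 \<in> loc R M" using v(1) RV R_1 loc_add[OF pM] by blast+
    from v(2) show "a + b \<in> P"
    proof
      assume "a = b * v"
      then have "(a + b) ^ l = b ^ l * (v + 1) ^ l"
        by (metis distrib_left mult.right_neutral power_mult_distrib)
      then show ?thesis using PI[of "a + b" l] ab R_add Amult[OF ab(4) vpow[OF w(2)]] by simp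
    next
      assume "b = a * v"
      then have "(a + b) ^ k = a ^ k * (1 + v) ^ k"
        by (metis distrib_left mult.right_neutral power_mult_distrib)
      then show ?thesis using PI[of "a + b" k] ab R_add Amult[OF ab(3) vpow[OF w(1)]] by simp
    qed
  next
    fix r a assume "r \<in> R" "a \<in> P"
    then obtain k where ra: "r \<in> R" "a \<in> R" "a ^ k \<in> A" unfolding P_def by blast
    then have "a ^ k * r ^ k \<in> A" using Amult R_power RV by blast
    then show "r * a \<in> P" using PI[of "r * a" k] ra R_mult by (simp add: power_mult_distrib mult.commute)
  next
    fix a b assume ab: "a \<in> R" "b \<in> R" "a * b \<in> P"
    then obtain k where k: "(a * b) ^ k \<in> A" unfolding P_def by blast
    from cmp[of a b] obtain v where v: "v \<in> loc R M" "a = b * v \<or> b = a * v" by blast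
    have kv: "(a * b * v) ^ k \<in> A" using Amult[OF k vpow[OF v(1)]] by (simp add: power_mult_distrib)
    from v(2) show "a \<in> P \<or> b \<in> P"
    proof
      assume "a = b * v"
      then have "a * b * v = a ^ 2" by (simp add: power2_eq_square mult_ac)
      then have "a ^ (2 * k) \<in> A" using kv by (simp add: power_mult)
      then show ?thesis using PI ab by blast
    next
      assume "b = a * v"
      then have "a * b * v = b ^ 2" by (simp add: power2_eq_square mult_ac)
      then have "b ^ (2 * k) \<in> A" using kv by (simp add: power_mult)
      then show ?thesis using PI ab by blast
    qed
  qed
  have PM: "P \<subseteq> M"
  proof
    fix r assume "r \<in> P"
    then obtain k where r: "r \<in> R" "r ^ k \<in> A" unfolding P_def by blast
    then obtain s where s: "s \<in> R" "s \<notin> M" "s * r ^ k \<in> trace I" unfolding A_def loc_ideal_def by blast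
    show "r \<in> M"
    proof (rule ccontr)
      assume "r \<notin> M"
      then have "r ^ k \<notin> M" using prime_power[OF pM r(1)] by blast
      then have "s * r ^ k \<notin> M" using s R_power[OF r(1)] primeD(5)[OF pM] by blast
      moreover have "s * r ^ k \<in> R" using s(1) r(1) R_mult R_power by blast
      ultimately have "1 \<in> A" using s(3) unfolding A_def loc_ideal_def by force
      with oneA show False by simp
    qed
  qed
  have xP: "x \<in> P" using PI x by (simp add: A_def)
  have tP: "t_prime R P"
    using xP x0 by (intro prime_valuation_t_prime[OF P] loc_valuation[OF M PM]) auto
  note VP = loc_valuation[OF M PM] and VW = loc_mono[OF PM]
  define N where "N = loc_ideal P P"
  have Nmult: "z * w \<in> N" if "z \<in> N" "w \<in> loc R P" for z w
    using that loc_ideal_mult[OF P primeD(1)[OF P]] unfolding N_def by blast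
  have PN: "P \<subseteq> N" unfolding N_def by (rule loc_ideal_superset[OF P])
  have RW: "R \<subseteq> loc R P" by (rule R_subset_loc[OF P])
  obtain G where G: "finite G" "G \<subseteq> P" "\<forall>M'. t_maximal R M' \<and> G \<subseteq> M' \<longrightarrow> P \<subseteq> M'"
    using sharp[OF tP] unfolding t_sharp_prime_def by (elim exE conjE)

  obtain s0 where s0: "s0 \<in> R" "s0 \<notin> M" "s0 * x ^ n \<in> trace I"
    using x(2) unfolding loc_ideal_def by blast
  have "s0 * x ^ n \<noteq> 0" using s0 x0 primeD(2)[OF pM] by auto
  \<comment> \<open>A single product \<open>i0 * u\<close>, called \<open>a\<close> below, divides
    \<open>s0 * x ^ n\<close> in \<open>loc R M\<close>; as \<open>s0\<close> is a unit there, it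
    also divides \<open>x ^ n\<close>.\<close>
  then obtain i0 u where iu: "i0 \<in> I" "u \<in> colon R I" "i0 * u \<noteq> 0"
    and d0: "s0 * x ^ n / (i0 * u) \<in> loc R M"
    using trace_loc_generator[OF pM V s0(3)] by blast
  define a where "a = i0 * u"
  have uI: "u * j \<in> R" if "j \<in> I" for j using iu(2) that by (auto simp: colon_def)
  have xa: "x ^ n / a \<in> loc R M"
  proof -
    obtain t where t: "t \<in> R" "t \<notin> M" "t * (s0 * x ^ n / a) \<in> R" using d0 unfolding a_def mM by blast
    have "t * s0 * (x ^ n / a) \<in> R" using t(3) by (simp add: mult.assoc)
    moreover have "t * s0 \<in> R" "t * s0 \<notin> M" using t s0 R_mult primeD(5)[OF pM] by blast+
    ultimately show ?thesis unfolding mM by blast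
  qed
  text \<open>Since \<open>A \<subset> xV\<close> and \<open>x\<^sup>n \<in> aV\<close>, the radical of \<open>aV\<close> is all of \<open>PV\<close>.\<close>
  have pow: "\<exists>m. c ^ m / a \<in> N" if c: "c \<in> P" for c
  proof -
    obtain k where k: "c ^ k \<in> A" using c unfolding P_def by blast
    obtain v where v: "v \<in> loc R M" "c ^ k = x * v" using Ax[OF k] by blast
    \<comment> \<open>The exponent \<open>k * n\<close> already gives a quotient in
      \<open>loc R P\<close>; the extra factor \<open>c\<close> moves it into the maximal ideal
      \<open>N\<close>.\<close>
    have "c ^ (k * n + 1) / a = c * (v ^ n * (x ^ n / a))"
      by (simp add: power_mult v(2) power_mult_distrib)
    moreover have "v ^ n * (x ^ n / a) \<in> loc R P" using loc_mult[OF pM vpow[OF v(1)] xa] VW by blast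
    ultimately have "c ^ (k * n + 1) / a \<in> N" using Nmult[of c] c PN by (metis subsetD)
    then show ?thesis by blast
  qed
  \<comment> \<open>Descent from \<open>i0\<close>: without such an \<open>i\<close>, each
    \<open>j\<close> reached is a multiple of \<open>x * j'\<close> over \<open>loc R P\<close> for
    some \<open>j' \<in> I\<close>, so \<open>i0\<close> lies in the extension of
    \<open>x^k I\<close> for every \<open>k\<close>. Choosing \<open>x ^ k / a \<in> N\<close> and
    multiplying by \<open>u\<close> gives \<open>1 \<in> N\<close>.\<close>
  have "\<exists>i\<in>I. i \<noteq> 0 \<and> i0 / i \<in> loc R P \<and> (\<forall>j\<in>I. x * j / i \<in> N)"
  proof (rule ccontr)
    assume no: "\<not> ?thesis"
    have "\<exists>j\<in>I. \<exists>w\<in>loc R P. i0 = x ^ k * j * w" for k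
    proof (induction k)
      case 0
      show ?case using iu(1) RW R_1 by (intro bexI[of _ i0] bexI[of _ 1]) auto
    next
      case (Suc k)
      then obtain j w where j: "j \<in> I" "w \<in> loc R P" "i0 = x ^ k * j * w" by blast
      then have j0: "j \<noteq> 0" using iu(3) by auto
      have "i0 / j = x ^ k * w" using j(3) j0 by simp
      then have "i0 / j \<in> loc R P" using loc_mult[OF P _ j(2)] RW R_power[OF x(1)] by auto
      then obtain j' where j': "j' \<in> I" "x * j' / j \<notin> N" using no j(1) j0 by blast
      then have nz: "x * j' / j \<noteq> 0" and inv: "inverse (x * j' / j) \<in> loc R P"
        using inverse_in_loc[OF P VP] unfolding N_def by blast+
      have "i0 = x ^ Suc k * j' * (inverse (x * j' / j) * w)"
        using nz j0 by (simp add: j(3) field_simps)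
      then show ?case using j'(1) loc_mult[OF P inv j(2)] by blast
    qed
    moreover obtain k where k: "x ^ k / a \<in> N" using pow[OF xP] by blast
    ultimately obtain j w where j: "j \<in> I" "w \<in> loc R P" "i0 = x ^ k * j * w" by blast
    have "a = x ^ k * ((u * j) * w)" by (simp add: a_def j(3) mult_ac)
    then have "x ^ k / a * ((u * j) * w) = 1" using iu(3) unfolding a_def
      by (metis divide_self times_divide_eq_left)
    moreover have "(u * j) * w \<in> loc R P" using loc_mult[OF P _ j(2)] uI[OF j(1)] RW by blast
    ultimately have "1 \<in> N" using Nmult[OF k] by metis
    then show False using one_notin_loc_ideal[OF P] by (simp add: N_def)
  qed
  then obtain i where i: "i \<in> I" "i \<noteq> 0" "i0 / i \<in> loc R P" "\<And>j. j \<in> I \<Longrightarrow> x * j / i \<in> N"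
    by blast
  \<comment> \<open>With this \<open>e\<close>, \<open>x * s / i * j\<close> equals
    \<open>s / e * (x * (u * j))\<close>, where \<open>u * j \<in> R\<close>; away from
    \<open>P\<close> it suffices to control \<open>s / e\<close>.\<close>
  define e where "e = u * i"
  have u0: "u \<noteq> 0" using iu(3) by auto
  \<comment> \<open>Since \<open>a / e = i0 / i\<close> lies in \<open>loc R P\<close>,
    \<open>pow\<close> transfers from \<open>a\<close> to \<open>e\<close>. All larger exponents are
    included so that the sum of the individual bounds serves all of \<open>G\<close>.\<close>
  have "\<exists>m. \<forall>k\<ge>m. g ^ k / e \<in> N" if g: "g \<in> G" for g
  proof -
    have gP: "g \<in> P" and gR: "g \<in> R" using g G(2) primeD(4)[OF P] by auto
    obtain m where m: "g ^ m / a \<in> N" using pow[OF gP] by blast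
    have "g ^ k / e \<in> N" if "k \<ge> m" for k
    proof -
      have "g ^ k = g ^ m * g ^ (k - m)" using that by (simp flip: power_add)
      then have "g ^ k / e = g ^ m / a * (g ^ (k - m) * (i0 / i))"
        using iu(3) i(2) by (simp add: e_def a_def field_simps)
      moreover have "g ^ (k - m) * (i0 / i) \<in> loc R P"
        using loc_mult[OF P _ i(3)] R_power[OF gR] RW by blast
      ultimately show ?thesis using Nmult[OF m] by metis
    qed
    then show ?thesis by blast
  qed
  then obtain mf where mf: "\<And>g k. g \<in> G \<Longrightarrow> k \<ge> mf g \<Longrightarrow> g ^ k / e \<in> N" by metis
  define m where "m = sum mf G"
  have gm: "g ^ m / e \<in> N" if "g \<in> G" for g
    using mf[OF that] member_le_sum[OF that, of mf] G(1) by (simp add: m_def)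
  have "(\<lambda>g. g ^ m / e) ` G \<subseteq> loc R M"
    using gm maximal_ideal_loc[OF P M PM] unfolding N_def by blast
  then obtain s where s: "s \<in> R" "s \<notin> M" "\<forall>f\<in>(\<lambda>g. g ^ m / e) ` G. s * f \<in> R"
    using loc_common_denominator[OF pM, of "(\<lambda>g. g ^ m / e) ` G"] G(1) by blast
  have "x * s / i \<in> colon R I"
    unfolding colon_def
  proof (intro CollectI ballI in_R_if_locally)
    fix j M' assume j: "j \<in> I" and M': "t_maximal R M'"
    note pM' = t_maximal_prime[OF M']
    note RM' = R_subset_loc[OF pM']
    show "x * s / i * j \<in> loc R M'"
    proof (cases "P \<subseteq> M'")
      case True
      then have "x * j / i \<in> loc R M'" using maximal_ideal_loc[OF P M'] i(4)[OF j] unfolding N_def by blast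
      then have "x * j / i * s \<in> loc R M'" using loc_mult[OF pM'] s(1) RM' by blast
      then show ?thesis by (simp add: mult_ac)
    next
      case False
      \<comment> \<open>Sharpness gives a \<open>g \<in> G\<close> that is a unit in
        \<open>loc R M'\<close>, and \<open>g ^ m\<close> is a denominator for
        \<open>s / e\<close>.\<close>
      then obtain g where g: "g \<in> G" "g \<notin> M'" using G(3) M' by blast
      have gR: "g \<in> R" using g(1) G(2) primeD(4)[OF P] by blast
      have "g ^ m \<notin> M'" using prime_power[OF pM' gR] g(2) by blast
      moreover have "g ^ m * (s / e) \<in> R" using s(3) g(1) by (auto simp: mult.commute)
      ultimately have "s / e \<in> loc R M'"
        using R_power[OF gR] unfolding mem_loc[OF primeD(2)[OF pM']] by blast
      then have "s / e * (x * (u * j)) \<in> loc R M'"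
        using loc_mult[OF pM', of "s / e" "x * (u * j)"] R_mult[OF x(1) uI[OF j]] RM' by blast
      moreover have "s / e * (x * (u * j)) = x * s / i * j"
        using u0 i(2) by (simp add: e_def field_simps)
      ultimately show ?thesis by metis
    qed
  qed
  then have "i * (x * s / i) \<in> trace I" using trace_mult[OF i(1)] by blast
  then have "s * x \<in> trace I" using i(2) by (simp add: mult.commute)
  with s xn show False unfolding loc_ideal_def by blast
qed

text \<open>Locally the t-closure adds nothing to the trace, so \<open>trace_locally_radical\<close>
  applies at each t-maximal ideal; \<open>in_t_closure_if_locally\<close> glues the results.\<close>

lemma sharp_imp_tRTP:
  assumes sharp: "\<And>P. t_prime R P \<Longrightarrow> t_sharp_prime P"
  shows "tRTP R"
  unfolding tRTP_def
proof (intro allI impI disjI2)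
  fix I assume I: "ideal R I \<and> I \<noteq> {0}"
  let ?T = "t_closure R (trace I)"
  have A: "ideal R (trace I)" and nz: "trace I \<noteq> {0}"
    using I ideal_trace subset_trace[of I] idealD(2)[of I] by blast+
  have T: "ideal R ?T" by (rule ideal_t_closure[OF A nz])
  have "x \<in> ?T" if x: "x \<in> R" "x ^ n \<in> ?T" for x n
  proof (rule in_t_closure_if_locally[OF A nz x(1)])
    fix M assume M: "t_maximal R M"
    have "x ^ n \<in> loc_ideal (trace I) M"
      using t_closure_loc_ideal[OF A t_maximal_prime[OF M] loc_valuation[OF M order_refl] x(2)] .
    then show "\<exists>s\<in>R. s \<notin> M \<and> s * x \<in> trace I"
      using trace_locally_radical[OF sharp _ M x(1)] I unfolding loc_ideal_def by blast
  qed
  moreover have "x \<in> rad R ?T" if "x \<in> ?T" for x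
    using that idealD(1)[OF T] unfolding rad_def by (auto intro: exI[of _ 1])
  ultimately have "rad R ?T = ?T" unfolding rad_def by blast
  with T show "radical_ideal R (t_closure R (submod_prod I (colon R I)))"
    by (simp add: radical_ideal_def trace_def)
qed

section \<open>From \<open>tRTP\<close> and branched primes to sharpness\<close>

lemma tRTP_branched_imp_sharp:
  assumes rtp: "tRTP R" and P: "t_prime R P" and br: "branched R P"
  shows "t_sharp_prime P"
proof (rule ccontr)
  assume ns: "\<not> t_sharp_prime P"
  have Pp: "prime_ideal R P" using P by (simp add: t_prime_def)
  note V = t_prime_valuation[OF P]
  obtain Q where Q: "primary_for R P Q" "Q \<noteq> P" using br unfolding branched_def by blast
  then have QI: "ideal R Q" and QR: "Q \<noteq> R" and radQ: "rad R Q = P"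
    and prim: "\<And>a b. a \<in> R \<Longrightarrow> b \<in> R \<Longrightarrow> a * b \<in> Q \<Longrightarrow> a \<in> Q \<or> b \<in> P"
    unfolding primary_for_def by auto
  obtain p where p: "p \<in> P" "p \<noteq> 0" using P by (rule t_prime_nonzeroE)
  then obtain k where "p ^ k \<in> Q" using radQ unfolding rad_def by blast
  then have nz: "Q \<noteq> {0}" using p(2) by auto
  \<comment> \<open>Powers of elements of \<open>P\<close> lie in \<open>Q\<close> and put
    \<open>y\<close> into \<open>loc R M\<close> for every t-maximal \<open>M\<close> not containing
    \<open>P\<close>. As \<open>P\<close> is not sharp, \<open>t_sharp_primeI\<close> forces
    \<open>y \<in> loc R P\<close>, and primariness removes the denominator
    \<open>s \<notin> P\<close>.\<close>
  have col: "y * q \<in> Q" if y: "y \<in> colon R Q" and q: "q \<in> Q" for y q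
  proof -
    have yR: "y * q' \<in> R" if "q' \<in> Q" for q' using y that by (auto simp: colon_def)
    have "y \<in> loc R M" if M: "t_maximal R M" "\<not> P \<subseteq> M" for M
    proof -
      obtain r where r: "r \<in> P" "r \<notin> M" using M(2) by blast
      then obtain l where l: "r \<in> R" "r ^ l \<in> Q" using radQ unfolding rad_def by blast
      have "r ^ l \<notin> M" using prime_power[OF t_maximal_prime[OF M(1)] l(1)] r(2) by blast
      moreover have "r ^ l * y \<in> R" using yR[OF l(2)] by (simp add: mult.commute)
      ultimately show ?thesis
        using R_power[OF l(1)] unfolding mem_loc[OF primeD(2)[OF t_maximal_prime[OF M(1)]]] by blast
    qed
    then have "y \<in> loc R P" using ns t_sharp_primeI[OF Pp, of y] by blast
    then obtain s where s: "s \<in> R" "s \<notin> P" "s * y \<in> R" unfolding mem_loc[OF primeD(2)[OF Pp]] by blast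
    have "(y * q) * s = (s * y) * q" by (simp add: mult_ac)
    then have "(y * q) * s \<in> Q" using idealD(4)[OF QI s(3) q] by (simp only:)
    then show ?thesis using prim[OF yR[OF q] s(1)] s(2) by blast
  qed
  have "trace Q \<subseteq> Q"
  proof
    fix z assume "z \<in> trace Q"
    then obtain n a b where "z = (\<Sum>k<(n::nat). a k * b k)" "\<And>k. k < n \<Longrightarrow> a k \<in> Q"
      "\<And>k. k < n \<Longrightarrow> b k \<in> colon R Q" by (rule traceE) blast
    then show "z \<in> Q" using col by (auto simp: mult.commute[of "a _"] intro!: ideal_sum[OF QI])
  qed
  then have "trace Q = Q" using subset_trace[OF QI] by blast
  moreover have "t_closure R Q = Q"
    using t_closure_primary[OF Q(1) Pp V] t_closure_superset[OF QI nz] by blast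
  ultimately have "t_closure R (submod_prod Q (colon R Q)) = Q" by (simp add: trace_def)
  \<comment> \<open>\<open>Q\<close> is proper, so \<open>tRTP\<close> leaves only the radical
    alternative, which would make \<open>Q\<close> equal to \<open>P\<close>.\<close>
  then have "radical_ideal R Q" using rtp QI nz QR unfolding tRTP_def by metis
  then show False using radQ Q(2) by (simp add: radical_ideal_def)
qed

end

theorem theorem1p10:
  fixes R :: "'k::field set"
  assumes "subring R" and "quotient_field_is_univ R" and "R \<noteq> UNIV"
    and "PvMD R"
  shows "(t_sharp_sharp R \<longrightarrow> tRTP R) \<and>
         (tRTP R \<and> (\<forall>P. t_prime R P \<longrightarrow> branched R P) \<longrightarrow> t_sharp_sharp R)"
proof -
  interpret pvmd R using assms by unfold_locales
  show ?thesis
    using t_sharp_sharp_imp_sharp sharp_imp_tRTP tRTP_branched_imp_sharp sharp_imp_t_sharp_sharp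
    by blast
qed

end
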